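(* Let $R$ be a commutative ring with identity and let $N$ be a proper submodule of a finitely generated faithful multiplication $R$-module $M$. Then $N$ is a weakly $J$-submodule of $M$ if and only if whenever $m_1,m_2\in M$ with $0\neq m_1m_2\subseteq N$, then $m_1\in J(M)$ or $m_2\in N$.
   Context: Rings are commutative with identity and modules are unital. $J(R)$ is the Jacobson radical of $R$; $J(M)$ is the intersection of all maximal submodules of $M$. For a submodule $N$ of $M$, $(N:M)=\{r\in R: rM\subseteq N\}$. An $R$-module $M$ is a multiplication module if every submodule $N$ of $M$ has the form $N=IM$ for some ideal $I$ of $R$. For submodules $K=I_1M$ and $L=I_2M$ of a multiplication module $M$, the product is the submodule $KL=I_1I_2M$; for elements $m_1,m_2\in M$, $m_1m_2$ denotes the submodule $\langle m_1\rangle\langle m_2\rangle$ (product of the cyclic submodules they generate). A proper submodule $N$ of $M$ is a weakly $J$-submodule if whenever $r\in R$, $m\in M$ satisfy $0\neq rm\in N$ and $r\notin (J(R)M:M)$, then $m\in N$. *)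

theory Defs
  imports "HOL-Algebra.Module" "HOL-Algebra.Ideal_Product"
begin

definition jacobson_radical :: "('a, 'r) ring_scheme \<Rightarrow> 'a set" where
  "jacobson_radical R = carrier R \<inter> \<Inter>{I. maximalideal I R}"

definition maximal_submodule ::
    "'b set \<Rightarrow> ('a, 'r) ring_scheme \<Rightarrow> ('a, 'b, 'm) module_scheme \<Rightarrow> bool" where
  "maximal_submodule N R M \<longleftrightarrow>
     submodule N R M \<and> N \<noteq> carrier M \<and>
     (\<forall>K. submodule K R M \<and> N \<subseteq> K \<longrightarrow> K = N \<or> K = carrier M)"

text \<open>As usual, the empty intersection is the whole module (and the whole ring above).\<close>

definition module_radical ::
    "('a, 'r) ring_scheme \<Rightarrow> ('a, 'b, 'm) module_scheme \<Rightarrow> 'b set" where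
  "module_radical R M = carrier M \<inter> \<Inter>{N. maximal_submodule N R M}"

definition submodule_gen ::
    "('a, 'r) ring_scheme \<Rightarrow> ('a, 'b, 'm) module_scheme \<Rightarrow> 'b set \<Rightarrow> 'b set" where
  "submodule_gen R M S = \<Inter>{N. submodule N R M \<and> S \<subseteq> N}"

definition finitely_generated_module ::
    "('a, 'r) ring_scheme \<Rightarrow> ('a, 'b, 'm) module_scheme \<Rightarrow> bool" where
  "finitely_generated_module R M \<longleftrightarrow>
     (\<exists>S. finite S \<and> S \<subseteq> carrier M \<and> submodule_gen R M S = carrier M)"

definition residual ::
    "('a, 'r) ring_scheme \<Rightarrow> ('a, 'b, 'm) module_scheme \<Rightarrow> 'b set \<Rightarrow> 'a set" where
  "residual R M N = {r \<in> carrier R. \<forall>m \<in> carrier M. r \<odot>\<^bsub>M\<^esub> m \<in> N}"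

definition faithful_module ::
    "('a, 'r) ring_scheme \<Rightarrow> ('a, 'b, 'm) module_scheme \<Rightarrow> bool" where
  "faithful_module R M \<longleftrightarrow> residual R M {\<zero>\<^bsub>M\<^esub>} = {\<zero>\<^bsub>R\<^esub>}"

text \<open>The submodule \<open>IM\<close>, i.e. all finite sums of products \<open>a m\<close> with \<open>a \<in> I\<close> and \<open>m \<in> M\<close>.\<close>

definition ideal_smult ::
    "('a, 'r) ring_scheme \<Rightarrow> ('a, 'b, 'm) module_scheme \<Rightarrow> 'a set \<Rightarrow> 'b set" where
  "ideal_smult R M I = submodule_gen R M {a \<odot>\<^bsub>M\<^esub> m | a m. a \<in> I \<and> m \<in> carrier M}"

definition multiplication_module ::
    "('a, 'r) ring_scheme \<Rightarrow> ('a, 'b, 'm) module_scheme \<Rightarrow> bool" where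
  "multiplication_module R M \<longleftrightarrow>
     (\<forall>N. submodule N R M \<longrightarrow> (\<exists>I. ideal I R \<and> N = ideal_smult R M I))"

text \<open>The product \<open>KL = I\<^sub>1I\<^sub>2M\<close> for \<open>K = I\<^sub>1M\<close> and \<open>L = I\<^sub>2M\<close>. It does not depend on the
  chosen presentations; see \<open>submodule_prod_ideal_smult\<close> below.\<close>

definition submodule_prod ::
    "('a, 'r) ring_scheme \<Rightarrow> ('a, 'b, 'm) module_scheme \<Rightarrow> 'b set \<Rightarrow> 'b set \<Rightarrow> 'b set" where
  "submodule_prod R M K L =
     (THE P. \<exists>I\<^sub>1 I\<^sub>2. ideal I\<^sub>1 R \<and> ideal I\<^sub>2 R \<and>
        K = ideal_smult R M I\<^sub>1 \<and> L = ideal_smult R M I\<^sub>2 \<and>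
        P = ideal_smult R M (I\<^sub>1 \<cdot>\<^bsub>R\<^esub> I\<^sub>2))"

definition elem_prod ::
    "('a, 'r) ring_scheme \<Rightarrow> ('a, 'b, 'm) module_scheme \<Rightarrow> 'b \<Rightarrow> 'b \<Rightarrow> 'b set" where
  "elem_prod R M m\<^sub>1 m\<^sub>2 =
     submodule_prod R M (submodule_gen R M {m\<^sub>1}) (submodule_gen R M {m\<^sub>2})"

definition weakly_J_submodule ::
    "'b set \<Rightarrow> ('a, 'r) ring_scheme \<Rightarrow> ('a, 'b, 'm) module_scheme \<Rightarrow> bool" where
  "weakly_J_submodule N R M \<longleftrightarrow>
     submodule N R M \<and> N \<noteq> carrier M \<and>
     (\<forall>r \<in> carrier R. \<forall>m \<in> carrier M.
        r \<odot>\<^bsub>M\<^esub> m \<noteq> \<zero>\<^bsub>M\<^esub> \<and> r \<odot>\<^bsub>M\<^esub> m \<in> N \<and>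
        r \<notin> residual R M (ideal_smult R M (jacobson_radical R)) \<longrightarrow> m \<in> N)"

lemma submodule_gen_least:
  assumes "submodule N R M" "S \<subseteq> N"
  shows "submodule_gen R M S \<subseteq> N"
  using assms unfolding submodule_gen_def by blast

lemma submodule_gen_incl: "S \<subseteq> submodule_gen R M S"
  unfolding submodule_gen_def by blast

lemma ideal_smultI:
  assumes "a \<in> I" "m \<in> carrier M"
  shows "a \<odot>\<^bsub>M\<^esub> m \<in> ideal_smult R M I"
  unfolding ideal_smult_def
  by (rule subsetD[OF submodule_gen_incl]) (use assms in blast)

context module
begin

lemma submodule_zero:
  assumes "submodule N R M"
  shows "\<zero>\<^bsub>M\<^esub> \<in> N"
  using subgroup.one_closed[OF submodule.axioms(1)[OF assms]] by simp

lemma submodule_gen_submodule: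
  assumes "S \<subseteq> carrier M"
  shows "submodule (submodule_gen R M S) R M"
proof (rule submoduleI)
  show "submodule_gen R M S \<subseteq> carrier M"
    using carrier_is_submodule assms by (rule submodule_gen_least)
next
  show "\<zero>\<^bsub>M\<^esub> \<in> submodule_gen R M S"
    unfolding submodule_gen_def using submodule_zero by blast
next
  fix x y
  assume "x \<in> submodule_gen R M S" "y \<in> submodule_gen R M S"
  then show "x \<oplus>\<^bsub>M\<^esub> y \<in> submodule_gen R M S"
    unfolding submodule_gen_def using submoduleE(5) by blast
next
  fix x
  assume "x \<in> submodule_gen R M S"
  then show "\<ominus>\<^bsub>M\<^esub> x \<in> submodule_gen R M S"
    unfolding submodule_gen_def using submoduleE(3) by blast
next
  fix a x
  assume "a \<in> carrier R" "x \<in> submodule_gen R M S"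
  then show "a \<odot>\<^bsub>M\<^esub> x \<in> submodule_gen R M S"
    unfolding submodule_gen_def using submoduleE(4) by blast
qed

lemma submodule_smult_vimage:
  assumes "submodule N R M" "a \<in> carrier R"
  shows "submodule {x \<in> carrier M. a \<odot>\<^bsub>M\<^esub> x \<in> N} R M"
proof (rule submoduleI)
  show "\<zero>\<^bsub>M\<^esub> \<in> {x \<in> carrier M. a \<odot>\<^bsub>M\<^esub> x \<in> N}"
    using assms submodule_zero by simp
next
  fix b x assume "b \<in> carrier R" "x \<in> {x \<in> carrier M. a \<odot>\<^bsub>M\<^esub> x \<in> N}"
  moreover from this have "a \<odot>\<^bsub>M\<^esub> (b \<odot>\<^bsub>M\<^esub> x) = b \<odot>\<^bsub>M\<^esub> (a \<odot>\<^bsub>M\<^esub> x)"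
    using assms(2) by (simp add: smult_assoc1[symmetric] R.m_comm)
  ultimately show "b \<odot>\<^bsub>M\<^esub> x \<in> {x \<in> carrier M. a \<odot>\<^bsub>M\<^esub> x \<in> N}"
    using submoduleE(4)[OF assms(1)] by simp
qed (simp_all add: assms(2) smult_r_distr smult_r_minus submoduleE(3,5)[OF assms(1)])

lemma ideal_smult_submodule:
  assumes "ideal I R"
  shows "submodule (ideal_smult R M I) R M"
  unfolding ideal_smult_def
  by (rule submodule_gen_submodule) (use ideal.Icarr[OF assms] in auto)

lemma ideal_smult_ideal_prod:
  assumes I: "ideal I R" and J: "ideal J R"
  shows "ideal_smult R M (I \<cdot>\<^bsub>R\<^esub> J) =
    submodule_gen R M {a \<odot>\<^bsub>M\<^esub> x | a x. a \<in> I \<and> x \<in> ideal_smult R M J}"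
    (is "?L = ?R")
proof
  let ?S = "{a \<odot>\<^bsub>M\<^esub> x | a x. a \<in> I \<and> x \<in> ideal_smult R M J}"
  have IJ: "ideal (I \<cdot>\<^bsub>R\<^esub> J) R"
    using I J by (rule R.ideal_prod_is_ideal)
  have SJ: "ideal_smult R M J \<subseteq> carrier M"
    using submoduleE(1)[OF ideal_smult_submodule[OF J]] .
  have R: "submodule ?R R M"
    by (rule submodule_gen_submodule) (use SJ ideal.Icarr[OF I] in auto)
  have "s \<odot>\<^bsub>M\<^esub> m \<in> ?R" if "s \<in> I \<cdot>\<^bsub>R\<^esub> J" "m \<in> carrier M" for s m
    using that(1)
  proof induction
    case (prod i j)
    have "j \<odot>\<^bsub>M\<^esub> m \<in> ideal_smult R M J"
      using prod(2) that(2) by (rule ideal_smultI)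
    then have "i \<odot>\<^bsub>M\<^esub> (j \<odot>\<^bsub>M\<^esub> m) \<in> ?R"
      using prod(1) by (intro subsetD[OF submodule_gen_incl]) blast
    then show ?case
      using prod that(2) ideal.Icarr[OF I] ideal.Icarr[OF J] by (simp add: smult_assoc1)
  next
    case (sum s t)
    then show ?case
      using R.ideal_prod_in_carrier[OF I J] that(2) submoduleE(5)[OF R]
      by (simp add: smult_l_distr subset_iff)
  qed
  then show "?L \<subseteq> ?R"
    unfolding ideal_smult_def[of R M "I \<cdot>\<^bsub>R\<^esub> J"]
    by (intro submodule_gen_least[OF R]) auto
  have L: "submodule ?L R M"
    by (rule ideal_smult_submodule[OF IJ])
  have "a \<odot>\<^bsub>M\<^esub> x \<in> ?L" if a: "a \<in> I" and x: "x \<in> ideal_smult R M J" for a x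
  proof -
    have aR: "a \<in> carrier R"
      using ideal.Icarr[OF I a] .
    have "a \<odot>\<^bsub>M\<^esub> (j \<odot>\<^bsub>M\<^esub> m) \<in> ?L" if "j \<in> J" "m \<in> carrier M" for j m
    proof -
      have "(a \<otimes>\<^bsub>R\<^esub> j) \<odot>\<^bsub>M\<^esub> m \<in> ?L"
        using ideal_prod.prod[OF a that(1), of R] that(2) by (rule ideal_smultI)
      then show ?thesis
        using aR ideal.Icarr[OF J that(1)] that(2) by (simp add: smult_assoc1)
    qed
    then have "ideal_smult R M J \<subseteq> {x \<in> carrier M. a \<odot>\<^bsub>M\<^esub> x \<in> ?L}"
      unfolding ideal_smult_def[of R M J]
      by (intro submodule_gen_least[OF submodule_smult_vimage[OF L aR]])
        (use ideal.Icarr[OF J] in auto)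
    then show ?thesis
      using x by blast
  qed
  then show "?R \<subseteq> ?L"
    by (intro submodule_gen_least[OF L]) auto
qed

lemma ideal_prod_commute:
  assumes "ideal I R" "ideal J R"
  shows "I \<cdot>\<^bsub>R\<^esub> J = J \<cdot>\<^bsub>R\<^esub> I"
proof -
  have "A \<cdot>\<^bsub>R\<^esub> B \<subseteq> B \<cdot>\<^bsub>R\<^esub> A" if "ideal A R" "ideal B R" for A B
  proof
    fix s assume "s \<in> A \<cdot>\<^bsub>R\<^esub> B"
    then show "s \<in> B \<cdot>\<^bsub>R\<^esub> A"
    proof induction
      case (prod i j)
      then show ?case
        using ideal_prod.prod[of j B i A R] ideal.Icarr[OF that(1)] ideal.Icarr[OF that(2)]
        by (simp add: R.m_comm)
    qed (rule ideal_prod.sum)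
  qed
  then show ?thesis
    using assms by blast
qed

theorem submodule_prod_ideal_smult:
  assumes "ideal I R" "ideal J R"
  shows "submodule_prod R M (ideal_smult R M I) (ideal_smult R M J) =
    ideal_smult R M (I \<cdot>\<^bsub>R\<^esub> J)"
proof -
  have "ideal_smult R M (I' \<cdot>\<^bsub>R\<^esub> J') = ideal_smult R M (I \<cdot>\<^bsub>R\<^esub> J)"
    if "ideal I' R" "ideal J' R" "ideal_smult R M I = ideal_smult R M I'"
      "ideal_smult R M J = ideal_smult R M J'" for I' J'
  proof -
    have "ideal_smult R M (I' \<cdot>\<^bsub>R\<^esub> J') = ideal_smult R M (I' \<cdot>\<^bsub>R\<^esub> J)"
      using that assms by (simp add: ideal_smult_ideal_prod)
    also have "\<dots> = ideal_smult R M (J \<cdot>\<^bsub>R\<^esub> I')"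
      using that assms ideal_prod_commute by metis
    also have "\<dots> = ideal_smult R M (J \<cdot>\<^bsub>R\<^esub> I)"
      using that assms by (simp add: ideal_smult_ideal_prod)
    also have "\<dots> = ideal_smult R M (I \<cdot>\<^bsub>R\<^esub> J)"
      using assms ideal_prod_commute by metis
    finally show ?thesis .
  qed
  then show ?thesis
    unfolding submodule_prod_def by (intro the_equality) (use assms in blast)+
qed

end

end

theory Submission
  imports Defs
begin

text \<open>
  Two facts about the radicals connect the two conditions. In every module
  \<open>J(R)M \<subseteq> J(M)\<close>, because the annihilator of a nonzero element of a simple quotient \<open>M/K\<close> is a
  maximal ideal (\<open>maximalideal_colon\<close>). Conversely, if \<open>M\<close> is finitely generated, faithful and a
  multiplication module, then \<open>rM \<subseteq> J(M)\<close> forces \<open>r \<in> J(R)\<close>: for a maximal ideal \<open>P\<close>, Nakayama's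
  argument gives \<open>PM \<noteq> M\<close> (\<open>ideal_smult_maximalideal_proper\<close>), the multiplication property makes
  \<open>PM\<close> a maximal submodule, and \<open>rM \<subseteq> PM\<close> is possible only for \<open>r \<in> P\<close>.

  The product of elements is concrete: if \<open>\<langle>m\<^sub>1\<rangle> = IM\<close>, then \<open>m\<^sub>1m\<^sub>2 = Im\<^sub>2\<close>, and the
  product is commutative. So a nonzero product inside \<open>N\<close> supplies scalars \<open>b \<in> I\<close> with
  \<open>0 \<noteq> bm\<^sub>2 \<in> N\<close>, while \<open>m\<^sub>1 \<notin> J(M)\<close> supplies scalars \<open>a \<in> I\<close> outside \<open>(J(R)M : M)\<close>. To
  get one scalar with both properties, observe that a group is not the union of two proper
  subgroups: one of \<open>a\<close>, \<open>b\<close>, \<open>a + b\<close> works. The other implication multiplies \<open>m\<close> by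
  elements \<open>rx\<close> with \<open>x \<in> M\<close>, and the same observation, now applied in \<open>M\<close>, finds an \<open>x\<close> for
  which \<open>rx \<notin> J(M)\<close> and the product of \<open>rx\<close> and \<open>m\<close> is nonzero.
\<close>

section \<open>Maximal ideals and the radical of a module\<close>

lemma (in cring) maximalideal_complement:
  assumes P: "maximalideal P R" and a: "a \<in> carrier R" "a \<notin> P"
  obtains b p where "b \<in> carrier R" "p \<in> P" "b \<otimes> a \<oplus> p = \<one>"
proof -
  have idP: "ideal P R" by (rule maximalideal.axioms(1)[OF P])
  have id: "ideal (PIdl a <+> P) R"
    by (rule add_ideals[OF cgenideal_ideal[OF a(1)] idP])
  have P_sub: "P \<subseteq> PIdl a <+> P"
  proof
    fix p assume "p \<in> P"
    moreover have "\<zero> \<in> PIdl a"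
      using additive_subgroup.zero_closed ideal.axioms(1)[OF cgenideal_ideal[OF a(1)]] by blast
    ultimately show "p \<in> PIdl a <+> P"
      unfolding set_add_def' using ideal.Icarr[OF idP] by force
  qed
  have "a \<in> PIdl a <+> P"
    unfolding set_add_def'
    using cgenideal_self[OF a(1)] additive_subgroup.zero_closed[OF ideal.axioms(1)[OF idP]] a(1)
    by force
  with a have "PIdl a <+> P = carrier R"
    using maximalideal.I_maximal[OF P id P_sub] ideal.Icarr[OF id] by blast
  then have "\<one> \<in> PIdl a <+> P" by simp
  then show thesis
    unfolding set_add_def' cgenideal_def using that by auto
qed

context module
begin

lemma submodule_ideal_line_add:
  assumes I: "ideal I R" and N: "submodule N R M" and x: "x \<in> carrier M"
  shows "submodule {a \<odot>\<^bsub>M\<^esub> x \<oplus>\<^bsub>M\<^esub> y | a y. a \<in> I \<and> y \<in> N} R M" (is "submodule ?S R M")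
proof (rule submoduleI)
  interpret I: ideal I R by (rule I)
  have NM: "y \<in> carrier M" if "y \<in> N" for y
    using that submoduleE(1)[OF N] by blast
  show "?S \<subseteq> carrier M"
    using NM x by auto
  show "\<zero>\<^bsub>M\<^esub> \<in> ?S"
  proof -
    have "\<zero>\<^bsub>M\<^esub> = \<zero> \<odot>\<^bsub>M\<^esub> x \<oplus>\<^bsub>M\<^esub> \<zero>\<^bsub>M\<^esub>"
      using x by (simp add: smult_l_null)
    then show ?thesis
      using submodule_zero[OF N] I.zero_closed by blast
  qed
  fix u assume "u \<in> ?S"
  then obtain a y where u: "u = a \<odot>\<^bsub>M\<^esub> x \<oplus>\<^bsub>M\<^esub> y" "a \<in> I" "y \<in> N" by blast
  have "\<ominus>\<^bsub>M\<^esub> u = (\<ominus> a) \<odot>\<^bsub>M\<^esub> x \<oplus>\<^bsub>M\<^esub> \<ominus>\<^bsub>M\<^esub> y"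
    using u x NM by (simp add: M.minus_add smult_l_minus)
  then show "\<ominus>\<^bsub>M\<^esub> u \<in> ?S"
    using u I.a_inv_closed submoduleE(3)[OF N] by blast
  show "c \<odot>\<^bsub>M\<^esub> u \<in> ?S" if c: "c \<in> carrier R" for c
  proof -
    have "c \<odot>\<^bsub>M\<^esub> u = (c \<otimes> a) \<odot>\<^bsub>M\<^esub> x \<oplus>\<^bsub>M\<^esub> c \<odot>\<^bsub>M\<^esub> y"
      using u x NM c by (simp add: smult_r_distr smult_assoc1)
    then show ?thesis
      using u I.I_l_closed[OF _ c] submoduleE(4)[OF N c] by blast
  qed
  fix v assume "v \<in> ?S"
  then obtain b z where v: "v = b \<odot>\<^bsub>M\<^esub> x \<oplus>\<^bsub>M\<^esub> z" "b \<in> I" "z \<in> N" by blast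
  have "u \<oplus>\<^bsub>M\<^esub> v = (a \<oplus> b) \<odot>\<^bsub>M\<^esub> x \<oplus>\<^bsub>M\<^esub> (y \<oplus>\<^bsub>M\<^esub> z)"
    using u v x NM by (simp add: smult_l_distr M.a_ac)
  then show "u \<oplus>\<^bsub>M\<^esub> v \<in> ?S"
    using u v I.a_closed submoduleE(5)[OF N] by blast
qed

lemma submodule_zero_set: "submodule {\<zero>\<^bsub>M\<^esub>} R M"
  by (rule submoduleI) auto

lemma submodule_ideal_line:
  assumes I: "ideal I R" and x: "x \<in> carrier M"
  shows "submodule {a \<odot>\<^bsub>M\<^esub> x | a. a \<in> I} R M"
proof -
  have "a \<odot>\<^bsub>M\<^esub> x \<oplus>\<^bsub>M\<^esub> \<zero>\<^bsub>M\<^esub> = a \<odot>\<^bsub>M\<^esub> x" if "a \<in> I" for a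
    using x ideal.Icarr[OF I that] by simp
  then have "{a \<odot>\<^bsub>M\<^esub> x \<oplus>\<^bsub>M\<^esub> y | a y. a \<in> I \<and> y \<in> {\<zero>\<^bsub>M\<^esub>}} = {a \<odot>\<^bsub>M\<^esub> x | a. a \<in> I}"
    by (simp add: set_eq_iff) metis
  then show ?thesis
    using submodule_ideal_line_add[OF I submodule_zero_set x] by simp
qed

lemma submodule_gen_singleton:
  assumes x: "x \<in> carrier M"
  shows "submodule_gen R M {x} = {a \<odot>\<^bsub>M\<^esub> x | a. a \<in> carrier R}"
proof
  show "submodule_gen R M {x} \<subseteq> {a \<odot>\<^bsub>M\<^esub> x | a. a \<in> carrier R}"
    by (rule submodule_gen_least[OF submodule_ideal_line[OF R.oneideal x]])
      (use x smult_one in force)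
  have "submodule (submodule_gen R M {x}) R M"
    using x by (intro submodule_gen_submodule) simp
  from submoduleE(4)[OF this] show "{a \<odot>\<^bsub>M\<^esub> x | a. a \<in> carrier R} \<subseteq> submodule_gen R M {x}"
    using submodule_gen_incl[of "{x}" R M] by blast
qed

lemma submodule_gen_insert_subset:
  assumes x: "x \<in> carrier M" and S: "S \<subseteq> carrier M"
  shows "submodule_gen R M (insert x S) \<subseteq>
    {a \<odot>\<^bsub>M\<^esub> x \<oplus>\<^bsub>M\<^esub> y | a y. a \<in> carrier R \<and> y \<in> submodule_gen R M S}" (is "_ \<subseteq> ?T")
proof (rule submodule_gen_least)
  have N: "submodule (submodule_gen R M S) R M"
    by (rule submodule_gen_submodule[OF S])
  show "submodule ?T R M"
    by (rule submodule_ideal_line_add[OF R.oneideal N x])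
  have "x = \<one> \<odot>\<^bsub>M\<^esub> x \<oplus>\<^bsub>M\<^esub> \<zero>\<^bsub>M\<^esub>"
    using x by simp
  then have "x \<in> ?T"
    using submodule_zero[OF N] R.one_closed by blast
  moreover have "y \<in> ?T" if y: "y \<in> S" for y
  proof -
    have "y = \<zero> \<odot>\<^bsub>M\<^esub> x \<oplus>\<^bsub>M\<^esub> y"
      using x y S by (auto simp: smult_l_null)
    then show ?thesis
      using y submodule_gen_incl[of S R M] R.zero_closed by blast
  qed
  ultimately show "insert x S \<subseteq> ?T"
    by blast
qed

lemma ideal_smult_least:
  assumes "submodule N R M" "\<And>a m. a \<in> I \<Longrightarrow> m \<in> carrier M \<Longrightarrow> a \<odot>\<^bsub>M\<^esub> m \<in> N"
  shows "ideal_smult R M I \<subseteq> N"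
  unfolding ideal_smult_def using assms by (intro submodule_gen_least) auto

lemma maximal_submodule_decomp:
  assumes K: "maximal_submodule K R M" and x: "x \<in> carrier M" "x \<notin> K" and m: "m \<in> carrier M"
  obtains b k where "b \<in> carrier R" "k \<in> K" "m = b \<odot>\<^bsub>M\<^esub> x \<oplus>\<^bsub>M\<^esub> k"
proof -
  let ?S = "{a \<odot>\<^bsub>M\<^esub> x \<oplus>\<^bsub>M\<^esub> y | a y. a \<in> carrier R \<and> y \<in> K}"
  have subK: "submodule K R M"
    using K unfolding maximal_submodule_def by blast
  note S = submodule_ideal_line_add[OF R.oneideal subK x(1)]
  have "y \<in> ?S" if y: "y \<in> K" for y
  proof -
    have "y = \<zero> \<odot>\<^bsub>M\<^esub> x \<oplus>\<^bsub>M\<^esub> y"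
      using x y submoduleE(1)[OF subK] by (auto simp: smult_l_null)
    then show ?thesis
      using y R.zero_closed by blast
  qed
  moreover have "x \<in> ?S"
  proof -
    have "x = \<one> \<odot>\<^bsub>M\<^esub> x \<oplus>\<^bsub>M\<^esub> \<zero>\<^bsub>M\<^esub>"
      using x by simp
    then show ?thesis
      using submodule_zero[OF subK] R.one_closed by blast
  qed
  ultimately have "?S = carrier M"
    using K S x(2) unfolding maximal_submodule_def by blast
  then show thesis
    using m that by blast
qed

text \<open>The ideal is the annihilator of \<open>x + K\<close> in the simple module \<open>M/K\<close>, which \<open>x + K\<close>
  generates: an ideal containing an \<open>a\<close> with \<open>ax \<notin> K\<close> contains some \<open>1 - ba\<close>, hence \<open>1\<close>.\<close>

lemma maximalideal_colon:
  assumes K: "maximal_submodule K R M" and x: "x \<in> carrier M" "x \<notin> K"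
  shows "maximalideal {a \<in> carrier R. a \<odot>\<^bsub>M\<^esub> x \<in> K} R" (is "maximalideal ?P R")
proof -
  have subK: "submodule K R M"
    using K unfolding maximal_submodule_def by blast
  have idP: "ideal ?P R"
  proof (rule idealI[OF R.ring_axioms])
    show "subgroup ?P (add_monoid R)"
    proof (rule R.add.subgroupI)
      show "?P \<noteq> {}"
        using submodule_zero[OF subK] x by (force simp: smult_l_null)
      fix a assume a: "a \<in> ?P"
      show "\<ominus> a \<in> ?P"
        using a x submoduleE(3)[OF subK] by (simp add: smult_l_minus)
      fix b assume "b \<in> ?P"
      then show "a \<oplus> b \<in> ?P"
        using a x submoduleE(5)[OF subK] by (simp add: smult_l_distr)
    qed auto
    fix a c assume ac: "a \<in> ?P" "c \<in> carrier R"
    then show "c \<otimes> a \<in> ?P"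
      using x submoduleE(4)[OF subK] by (simp add: smult_assoc1)
    with ac show "a \<otimes> c \<in> ?P"
      by (simp add: R.m_comm)
  qed
  show ?thesis
  proof (rule maximalidealI[OF idP])
    show "carrier R \<noteq> ?P"
      using x R.one_closed by (metis (no_types, lifting) mem_Collect_eq smult_one)
    fix J assume J: "ideal J R" "?P \<subseteq> J"
    interpret J: ideal J R by (rule J(1))
    show "J = ?P \<or> J = carrier R"
    proof (rule disjCI)
      assume "J \<noteq> carrier R"
      then have one: "\<one> \<notin> J"
        using J.one_imp_carrier by blast
      have "a \<odot>\<^bsub>M\<^esub> x \<in> K" if a: "a \<in> J" for a
      proof (rule ccontr)
        assume nK: "a \<odot>\<^bsub>M\<^esub> x \<notin> K"
        have aR: "a \<in> carrier R" using a by simp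
        obtain b k where b: "b \<in> carrier R" "k \<in> K" "x = b \<odot>\<^bsub>M\<^esub> (a \<odot>\<^bsub>M\<^esub> x) \<oplus>\<^bsub>M\<^esub> k"
          using maximal_submodule_decomp[OF K _ nK x(1)] x aR by blast
        have k: "k \<in> carrier M"
          using b(2) submoduleE(1)[OF subK] by blast
        have "(\<one> \<oplus> \<ominus> (b \<otimes> a)) \<odot>\<^bsub>M\<^esub> x = x \<oplus>\<^bsub>M\<^esub> \<ominus>\<^bsub>M\<^esub> (b \<odot>\<^bsub>M\<^esub> (a \<odot>\<^bsub>M\<^esub> x))"
          using b(1) aR x by (simp add: smult_l_distr smult_l_minus smult_assoc1)
        also have "\<dots> = (b \<odot>\<^bsub>M\<^esub> (a \<odot>\<^bsub>M\<^esub> x) \<oplus>\<^bsub>M\<^esub> k) \<oplus>\<^bsub>M\<^esub> \<ominus>\<^bsub>M\<^esub> (b \<odot>\<^bsub>M\<^esub> (a \<odot>\<^bsub>M\<^esub> x))"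
          using b(3) by simp
        also have "\<dots> = k"
          using b(1) aR x(1) k by (simp add: M.a_ac M.r_neg M.r_neg2 M.r_neg1)
        finally have "\<one> \<oplus> \<ominus> (b \<otimes> a) \<in> J"
          using J(2) b(1,2) aR by auto
        moreover have ba: "b \<otimes> a \<in> J"
          using a b(1) by (rule J.I_l_closed)
        ultimately have "(\<one> \<oplus> \<ominus> (b \<otimes> a)) \<oplus> b \<otimes> a \<in> J"
          by (rule J.a_closed)
        then show False
          using one b(1) aR by (simp add: R.a_assoc R.l_neg)
      qed
      then show "J = ?P"
        using J(2) J.Icarr by blast
    qed
  qed
qed

lemma ideal_smult_jacobson_radical_subset:
  "ideal_smult R M (jacobson_radical R) \<subseteq> module_radical R M"
proof -
  have "ideal_smult R M (jacobson_radical R) \<subseteq> K" if K: "maximal_submodule K R M" for K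
  proof (rule ideal_smult_least)
    show subK: "submodule K R M"
      using K unfolding maximal_submodule_def by blast
    fix a m assume am: "a \<in> jacobson_radical R" "m \<in> carrier M"
    have aR: "a \<in> carrier R"
      using am(1) unfolding jacobson_radical_def by blast
    show "a \<odot>\<^bsub>M\<^esub> m \<in> K"
    proof (cases "m \<in> K")
      case True
      then show ?thesis using aR submoduleE(4)[OF subK] by blast
    next
      case False
      then show ?thesis
        using am maximalideal_colon[OF K am(2)] unfolding jacobson_radical_def by blast
    qed
  qed
  moreover have "ideal_smult R M (jacobson_radical R) \<subseteq> carrier M"
    by (rule ideal_smult_least[OF carrier_is_submodule]) (auto simp: jacobson_radical_def)
  ultimately show ?thesis
    unfolding module_radical_def by blast
qed

lemma module_radical_submodule: "submodule (module_radical R M) R M"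
proof -
  have sub: "submodule K R M" if "maximal_submodule K R M" for K
    using that unfolding maximal_submodule_def by blast
  show ?thesis
    unfolding module_radical_def
    by (rule submoduleI)
      (auto intro: submodule_zero[OF sub] submoduleE(3,4,5)[OF sub])
qed

section \<open>Nakayama's argument for maximal ideals\<close>

text \<open>If \<open>PM = M\<close>, generators can be discarded one at a time at the cost of enlarging a
  denominator \<open>s \<notin> P\<close>: from \<open>sM \<subseteq> \<langle>x, S\<rangle>\<close> one gets
  \<open>sM = sPM \<subseteq> Px + \<langle>S\<rangle>\<close>, so \<open>sx = px + y\<close> with \<open>p \<in> P\<close>, and
  \<open>(s - p)s\<close> is a denominator for \<open>S\<close>.\<close>

lemma annihilator_outside_maximalideal:
  assumes P: "maximalideal P R" and PM: "ideal_smult R M P = carrier M"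
    and "finite S" "S \<subseteq> carrier M" "s \<in> carrier R" "s \<notin> P"
    and "\<And>m. m \<in> carrier M \<Longrightarrow> s \<odot>\<^bsub>M\<^esub> m \<in> submodule_gen R M S"
  shows "\<exists>t \<in> carrier R. t \<notin> P \<and> (\<forall>m \<in> carrier M. t \<odot>\<^bsub>M\<^esub> m = \<zero>\<^bsub>M\<^esub>)"
  using assms(3-)
proof (induction S arbitrary: s rule: finite_induct)
  case empty
  have "submodule_gen R M {} \<subseteq> {\<zero>\<^bsub>M\<^esub>}"
    by (rule submodule_gen_least[OF submodule_zero_set]) simp
  then show ?case
    using empty by blast
next
  case (insert x S s)
  interpret P: maximalideal P R by (rule P)
  interpret pP: primeideal P R by (rule R.maximalideal_prime[OF P])
  let ?N = "submodule_gen R M S"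
  let ?T = "{a \<odot>\<^bsub>M\<^esub> x \<oplus>\<^bsub>M\<^esub> y | a y. a \<in> P \<and> y \<in> ?N}"
  have x: "x \<in> carrier M" and S: "S \<subseteq> carrier M"
    using insert.prems(1) by auto
  note s = insert.prems(2,3)
  have N: "submodule ?N R M"
    by (rule submodule_gen_submodule[OF S])
  have NM: "y \<in> carrier M" if "y \<in> ?N" for y
    using that submoduleE(1)[OF N] by blast
  have T: "submodule ?T R M"
    by (rule submodule_ideal_line_add[OF P.ideal_axioms N x])
  have gen: "\<exists>a y. s \<odot>\<^bsub>M\<^esub> m = a \<odot>\<^bsub>M\<^esub> x \<oplus>\<^bsub>M\<^esub> y \<and> a \<in> carrier R \<and> y \<in> ?N"
    if "m \<in> carrier M" for m
    using insert.prems(4)[OF that] submodule_gen_insert_subset[OF x S] by blast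
  have "ideal_smult R M P \<subseteq> {m \<in> carrier M. s \<odot>\<^bsub>M\<^esub> m \<in> ?T}"
  proof (rule ideal_smult_least[OF submodule_smult_vimage[OF T s(1)]])
    fix p m assume p: "p \<in> P" and m: "m \<in> carrier M"
    obtain a y where ay: "s \<odot>\<^bsub>M\<^esub> m = a \<odot>\<^bsub>M\<^esub> x \<oplus>\<^bsub>M\<^esub> y" "a \<in> carrier R" "y \<in> ?N"
      using gen[OF m] by blast
    have pR: "p \<in> carrier R"
      using p by simp
    have "s \<odot>\<^bsub>M\<^esub> (p \<odot>\<^bsub>M\<^esub> m) = p \<odot>\<^bsub>M\<^esub> (s \<odot>\<^bsub>M\<^esub> m)"
      using s(1) pR m by (simp add: smult_assoc1[symmetric] R.m_comm)
    also have "\<dots> = (p \<otimes> a) \<odot>\<^bsub>M\<^esub> x \<oplus>\<^bsub>M\<^esub> p \<odot>\<^bsub>M\<^esub> y"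
      using ay pR x NM by (simp add: smult_r_distr smult_assoc1)
    finally show "p \<odot>\<^bsub>M\<^esub> m \<in> {m \<in> carrier M. s \<odot>\<^bsub>M\<^esub> m \<in> ?T}"
      using P.I_r_closed[OF p ay(2)] submoduleE(4)[OF N pR ay(3)] pR m by blast
  qed
  then have "s \<odot>\<^bsub>M\<^esub> x \<in> ?T"
    using PM x by blast
  then obtain p y where py: "s \<odot>\<^bsub>M\<^esub> x = p \<odot>\<^bsub>M\<^esub> x \<oplus>\<^bsub>M\<^esub> y" "p \<in> P" "y \<in> ?N"
    by blast
  have pR: "p \<in> carrier R"
    using py(2) by simp
  let ?d = "s \<oplus> \<ominus> p"
  have d: "?d \<in> carrier R"
    using s pR by simp
  have "?d \<odot>\<^bsub>M\<^esub> x = (p \<odot>\<^bsub>M\<^esub> x \<oplus>\<^bsub>M\<^esub> y) \<oplus>\<^bsub>M\<^esub> \<ominus>\<^bsub>M\<^esub> (p \<odot>\<^bsub>M\<^esub> x)"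
    using s pR x py(1) by (simp add: smult_l_distr smult_l_minus)
  also have "\<dots> = y"
    using pR x NM[OF py(3)] by (simp add: M.a_ac M.r_neg M.r_neg2 M.r_neg1)
  finally have dx: "?d \<odot>\<^bsub>M\<^esub> x \<in> ?N"
    using py(3) by simp
  have dP: "?d \<notin> P"
  proof
    assume "?d \<in> P"
    then have "?d \<oplus> p \<in> P"
      using py(2) by (rule P.a_closed)
    then show False
      using s pR by (simp add: R.a_assoc R.l_neg)
  qed
  show ?case
  proof (rule insert.IH[OF S])
    show "?d \<otimes> s \<in> carrier R"
      using d s by simp
    show "?d \<otimes> s \<notin> P"
      using pP.I_prime[OF d s(1)] dP s(2) by blast
    fix m assume m: "m \<in> carrier M"
    obtain a z where az: "s \<odot>\<^bsub>M\<^esub> m = a \<odot>\<^bsub>M\<^esub> x \<oplus>\<^bsub>M\<^esub> z" "a \<in> carrier R" "z \<in> ?N"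
      using gen[OF m] by blast
    have "(?d \<otimes> s) \<odot>\<^bsub>M\<^esub> m = ?d \<odot>\<^bsub>M\<^esub> (a \<odot>\<^bsub>M\<^esub> x \<oplus>\<^bsub>M\<^esub> z)"
      unfolding az(1)[symmetric] using d s m by (intro smult_assoc1)
    also have "\<dots> = ?d \<odot>\<^bsub>M\<^esub> (a \<odot>\<^bsub>M\<^esub> x) \<oplus>\<^bsub>M\<^esub> ?d \<odot>\<^bsub>M\<^esub> z"
      using d az x NM by (intro smult_r_distr) auto
    also have "?d \<odot>\<^bsub>M\<^esub> (a \<odot>\<^bsub>M\<^esub> x) = a \<odot>\<^bsub>M\<^esub> (?d \<odot>\<^bsub>M\<^esub> x)"
      using d az(2) x R.m_comm by (metis smult_assoc1)
    finally show "(?d \<otimes> s) \<odot>\<^bsub>M\<^esub> m \<in> ?N"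
      using submoduleE(4)[OF N az(2) dx] submoduleE(4)[OF N d az(3)] submoduleE(5)[OF N] by simp
  qed
qed

lemma ideal_smult_maximalideal_proper:
  assumes fg: "finitely_generated_module R M" and ff: "faithful_module R M"
    and P: "maximalideal P R"
  shows "ideal_smult R M P \<noteq> carrier M"
proof
  assume PM: "ideal_smult R M P = carrier M"
  interpret P: maximalideal P R by (rule P)
  obtain S where S: "finite S" "S \<subseteq> carrier M" "submodule_gen R M S = carrier M"
    using fg unfolding finitely_generated_module_def by blast
  have "\<one> \<notin> P"
    using P.one_imp_carrier P.I_notcarr by blast
  then obtain t where t: "t \<in> carrier R" "t \<notin> P" "\<forall>m \<in> carrier M. t \<odot>\<^bsub>M\<^esub> m = \<zero>\<^bsub>M\<^esub>"
    using annihilator_outside_maximalideal[OF P PM S(1,2) R.one_closed] S(3) by auto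
  then have "t = \<zero>"
    using ff unfolding faithful_module_def residual_def by blast
  then show False
    using t(2) P.zero_closed by simp
qed

text \<open>A submodule containing \<open>PM\<close> is some \<open>IM\<close>; either \<open>I \<subseteq> P\<close>, or \<open>I\<close> and \<open>P\<close> are comaximal,
  which forces \<open>IM = M\<close>.\<close>

lemma ideal_smult_maximal_submodule:
  assumes mult: "multiplication_module R M"
    and P: "maximalideal P R" and ne: "ideal_smult R M P \<noteq> carrier M"
  shows "maximal_submodule (ideal_smult R M P) R M"
proof -
  interpret P: maximalideal P R by (rule P)
  have "K = carrier M" if K: "submodule K R M" "ideal_smult R M P \<subseteq> K"
    and neq: "K \<noteq> ideal_smult R M P" for K
  proof -
    obtain I where I: "ideal I R" "K = ideal_smult R M I"
      using mult K(1) unfolding multiplication_module_def by blast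
    have "\<not> I \<subseteq> P"
    proof
      assume "I \<subseteq> P"
      then have "K \<subseteq> ideal_smult R M P"
        unfolding I(2)
        by (intro ideal_smult_least[OF ideal_smult_submodule[OF P.ideal_axioms]])
          (auto intro: ideal_smultI)
      then show False
        using K(2) neq by blast
    qed
    then obtain i where i: "i \<in> I" "i \<notin> P"
      by blast
    have iR: "i \<in> carrier R"
      using ideal.Icarr[OF I(1) i(1)] .
    obtain b p where bp: "b \<in> carrier R" "p \<in> P" "b \<otimes> i \<oplus> p = \<one>"
      using R.maximalideal_complement[OF P iR i(2)] by blast
    have "m \<in> K" if m: "m \<in> carrier M" for m
    proof -
      have "(b \<otimes> i) \<odot>\<^bsub>M\<^esub> m \<in> K"
        unfolding I(2) using ideal.I_l_closed[OF I(1) i(1) bp(1)] m by (rule ideal_smultI)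
      moreover have "p \<odot>\<^bsub>M\<^esub> m \<in> K"
        using K(2) ideal_smultI[OF bp(2) m] by blast
      moreover have "m = (b \<otimes> i) \<odot>\<^bsub>M\<^esub> m \<oplus>\<^bsub>M\<^esub> p \<odot>\<^bsub>M\<^esub> m"
        using smult_l_distr[of "b \<otimes> i" p m] bp iR m by simp
      ultimately show ?thesis
        using submoduleE(5)[OF K(1)] by metis
    qed
    then show ?thesis
      using submoduleE(1)[OF K(1)] by blast
  qed
  then show ?thesis
    unfolding maximal_submodule_def
    using ne ideal_smult_submodule[OF P.ideal_axioms] by blast
qed

text \<open>If \<open>r \<notin> P\<close> and \<open>br + p = 1\<close> with \<open>p \<in> P\<close>, then \<open>M = brM + pM\<close> would lie in the maximal
  submodule \<open>PM\<close> as soon as \<open>rM\<close> does.\<close>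

lemma residual_module_radical_subset:
  assumes fg: "finitely_generated_module R M" and ff: "faithful_module R M"
    and mult: "multiplication_module R M"
  shows "residual R M (module_radical R M) \<subseteq> jacobson_radical R"
proof
  fix r assume r: "r \<in> residual R M (module_radical R M)"
  then have rR: "r \<in> carrier R"
    unfolding residual_def by blast
  have "r \<in> P" if P: "maximalideal P R" for P
  proof (rule ccontr)
    assume "r \<notin> P"
    then obtain b p where bp: "b \<in> carrier R" "p \<in> P" "b \<otimes> r \<oplus> p = \<one>"
      using R.maximalideal_complement[OF P rR] by blast
    interpret P: maximalideal P R by (rule P)
    let ?K = "ideal_smult R M P"
    note ne = ideal_smult_maximalideal_proper[OF fg ff P]
    have K: "submodule ?K R M"
      by (rule ideal_smult_submodule[OF P.ideal_axioms])
    have rK: "r \<odot>\<^bsub>M\<^esub> m \<in> ?K" if "m \<in> carrier M" for m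
      using r ideal_smult_maximal_submodule[OF mult P ne] that
      unfolding residual_def module_radical_def by blast
    have "m \<in> ?K" if m: "m \<in> carrier M" for m
    proof -
      have "m = b \<odot>\<^bsub>M\<^esub> (r \<odot>\<^bsub>M\<^esub> m) \<oplus>\<^bsub>M\<^esub> p \<odot>\<^bsub>M\<^esub> m"
        using smult_l_distr[of "b \<otimes> r" p m] bp rR m by (simp add: smult_assoc1)
      then show ?thesis
        using submoduleE(4)[OF K bp(1) rK[OF m]] ideal_smultI[OF bp(2) m] submoduleE(5)[OF K]
        by metis
    qed
    then show False
      using ne submoduleE(1)[OF K] by blast
  qed
  then show "r \<in> jacobson_radical R"
    using rR unfolding jacobson_radical_def by blast
qed

section \<open>Products of elements\<close>

lemma cyclic_eq_ideal_smult:
  assumes mult: "multiplication_module R M" and m: "m \<in> carrier M"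
  obtains I where "ideal I R" "submodule_gen R M {m} = ideal_smult R M I"
proof -
  have "submodule (submodule_gen R M {m}) R M"
    using m by (intro submodule_gen_submodule) simp
  then show thesis
    using mult that unfolding multiplication_module_def by blast
qed

lemma elem_prod_commute:
  assumes mult: "multiplication_module R M" and m: "m\<^sub>1 \<in> carrier M" "m\<^sub>2 \<in> carrier M"
  shows "elem_prod R M m\<^sub>1 m\<^sub>2 = elem_prod R M m\<^sub>2 m\<^sub>1"
proof -
  obtain I where I: "ideal I R" "submodule_gen R M {m\<^sub>1} = ideal_smult R M I"
    by (rule cyclic_eq_ideal_smult[OF mult m(1)])
  obtain J where J: "ideal J R" "submodule_gen R M {m\<^sub>2} = ideal_smult R M J"
    by (rule cyclic_eq_ideal_smult[OF mult m(2)])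
  from I J show ?thesis
    unfolding elem_prod_def
    by (simp add: submodule_prod_ideal_smult ideal_prod_commute[OF I(1) J(1)])
qed

lemma elem_prod_eq_ideal_line:
  assumes mult: "multiplication_module R M" and m: "m\<^sub>1 \<in> carrier M" "m\<^sub>2 \<in> carrier M"
    and I: "ideal I R" "submodule_gen R M {m\<^sub>1} = ideal_smult R M I"
  shows "elem_prod R M m\<^sub>1 m\<^sub>2 = {a \<odot>\<^bsub>M\<^esub> m\<^sub>2 | a. a \<in> I}"
proof -
  obtain J where J: "ideal J R" "submodule_gen R M {m\<^sub>2} = ideal_smult R M J"
    by (rule cyclic_eq_ideal_smult[OF mult m(2)])
  let ?S = "{a \<odot>\<^bsub>M\<^esub> x | a x. a \<in> I \<and> x \<in> submodule_gen R M {m\<^sub>2}}"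
  have "elem_prod R M m\<^sub>1 m\<^sub>2 = submodule_gen R M ?S"
    unfolding elem_prod_def I(2) J(2) submodule_prod_ideal_smult[OF I(1) J(1)]
    by (rule ideal_smult_ideal_prod[OF I(1) J(1)])
  also have "\<dots> = {a \<odot>\<^bsub>M\<^esub> m\<^sub>2 | a. a \<in> I}"
  proof
    show "submodule_gen R M ?S \<subseteq> {a \<odot>\<^bsub>M\<^esub> m\<^sub>2 | a. a \<in> I}"
    proof (rule submodule_gen_least[OF submodule_ideal_line[OF I(1) m(2)]], clarify)
      fix a x assume a: "a \<in> I" and x: "x \<in> submodule_gen R M {m\<^sub>2}"
      obtain c where c: "c \<in> carrier R" "x = c \<odot>\<^bsub>M\<^esub> m\<^sub>2"
        using x submodule_gen_singleton[OF m(2)] by blast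
      have "a \<odot>\<^bsub>M\<^esub> x = (a \<otimes> c) \<odot>\<^bsub>M\<^esub> m\<^sub>2"
        using c m ideal.Icarr[OF I(1) a] by (simp add: smult_assoc1)
      then show "\<exists>d. a \<odot>\<^bsub>M\<^esub> x = d \<odot>\<^bsub>M\<^esub> m\<^sub>2 \<and> d \<in> I"
        using ideal.I_r_closed[OF I(1) a c(1)] by blast
    qed
    show "{a \<odot>\<^bsub>M\<^esub> m\<^sub>2 | a. a \<in> I} \<subseteq> submodule_gen R M ?S"
      using submodule_gen_incl[of "{m\<^sub>2}" R M] submodule_gen_incl[of ?S R M] by blast
  qed
  finally show ?thesis .
qed

section \<open>The two implications\<close>

text \<open>With \<open>\<langle>m\<^sub>1\<rangle> = IM\<close>, the scalars of \<open>I\<close> that kill \<open>m\<^sub>2\<close> and those in \<open>(J(R)M : M)\<close> form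
  two subgroups of \<open>I\<close>. Both are proper: the first because \<open>Im\<^sub>2 \<noteq> 0\<close>, the second because
  otherwise \<open>m\<^sub>1 \<in> IM \<subseteq> J(R)M \<subseteq> J(M)\<close>.\<close>

lemma weakly_J_submodule_elem_prod:
  assumes mult: "multiplication_module R M" and wJ: "weakly_J_submodule N R M"
    and m: "m\<^sub>1 \<in> carrier M" "m\<^sub>2 \<in> carrier M"
    and prod: "elem_prod R M m\<^sub>1 m\<^sub>2 \<noteq> {\<zero>\<^bsub>M\<^esub>}" "elem_prod R M m\<^sub>1 m\<^sub>2 \<subseteq> N"
    and m1: "m\<^sub>1 \<notin> module_radical R M"
  shows "m\<^sub>2 \<in> N"
proof -
  let ?JM = "ideal_smult R M (jacobson_radical R)"
  let ?Q = "residual R M ?JM"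
  obtain I where I: "ideal I R" "submodule_gen R M {m\<^sub>1} = ideal_smult R M I"
    by (rule cyclic_eq_ideal_smult[OF mult m(1)])
  interpret I: ideal I R by (rule I(1))
  note eq = elem_prod_eq_ideal_line[OF mult m I]
  have JM: "submodule ?JM R M"
    unfolding ideal_smult_def by (rule submodule_gen_submodule) (auto simp: jacobson_radical_def)
  have step: "m\<^sub>2 \<in> N" if "c \<in> I" "c \<odot>\<^bsub>M\<^esub> m\<^sub>2 \<noteq> \<zero>\<^bsub>M\<^esub>" "c \<notin> ?Q" for c
    using wJ that m(2) prod(2) I.Icarr unfolding weakly_J_submodule_def eq by blast
  have "\<not> I \<subseteq> ?Q"
  proof
    assume "I \<subseteq> ?Q"
    then have "ideal_smult R M I \<subseteq> ?JM"
      unfolding residual_def by (intro ideal_smult_least[OF JM]) blast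
    then show False
      using m1 I(2) submodule_gen_incl[of "{m\<^sub>1}" R M] ideal_smult_jacobson_radical_subset by blast
  qed
  then obtain a where a: "a \<in> I" "a \<notin> ?Q"
    by blast
  have "\<zero>\<^bsub>M\<^esub> \<in> elem_prod R M m\<^sub>1 m\<^sub>2"
    unfolding eq by (rule submodule_zero[OF submodule_ideal_line[OF I(1) m(2)]])
  then obtain b where b: "b \<in> I" "b \<odot>\<^bsub>M\<^esub> m\<^sub>2 \<noteq> \<zero>\<^bsub>M\<^esub>"
    using prod(1) unfolding eq by blast
  have ab: "a \<in> carrier R" "b \<in> carrier R"
    using a b by auto
  consider "a \<odot>\<^bsub>M\<^esub> m\<^sub>2 \<noteq> \<zero>\<^bsub>M\<^esub>" | "b \<notin> ?Q" | "a \<odot>\<^bsub>M\<^esub> m\<^sub>2 = \<zero>\<^bsub>M\<^esub>" "b \<in> ?Q"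
    by blast
  then show ?thesis
  proof cases
    case 3
    have "a \<oplus> b \<notin> ?Q"
    proof
      assume *: "a \<oplus> b \<in> ?Q"
      have "a \<odot>\<^bsub>M\<^esub> x \<in> ?JM" if x: "x \<in> carrier M" for x
      proof -
        have "a \<odot>\<^bsub>M\<^esub> x = (a \<oplus> b) \<odot>\<^bsub>M\<^esub> x \<oplus>\<^bsub>M\<^esub> \<ominus>\<^bsub>M\<^esub> (b \<odot>\<^bsub>M\<^esub> x)"
          using ab x by (simp add: smult_l_distr M.a_assoc M.r_neg)
        also have "\<dots> \<in> ?JM"
          using * 3(2) x unfolding residual_def
          by (intro submoduleE(5)[OF JM] submoduleE(3)[OF JM]) blast+
        finally show ?thesis .
      qed
      then show False
        using a(2) ab unfolding residual_def by blast
    qed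
    moreover have "(a \<oplus> b) \<odot>\<^bsub>M\<^esub> m\<^sub>2 = b \<odot>\<^bsub>M\<^esub> m\<^sub>2"
      using ab m 3 by (simp add: smult_l_distr)
    ultimately show ?thesis
      using step[of "a \<oplus> b"] a b by simp
  qed (use step a b in auto)
qed

text \<open>The ideal \<open>I\<close> represents \<open>\<langle>m\<rangle>\<close>, so that the product of \<open>rx\<close> and \<open>m\<close> is \<open>Irx = r(Ix)\<close>,
  which lies in \<open>r\<langle>m\<rangle> \<subseteq> N\<close> whatever \<open>x\<close> is.\<close>

lemma elem_prod_imp_weakly_J_submodule:
  assumes fg: "finitely_generated_module R M" and ff: "faithful_module R M"
    and mult: "multiplication_module R M"
    and N: "submodule N R M" "N \<noteq> carrier M"
    and cond: "\<And>m\<^sub>1 m\<^sub>2. \<lbrakk>m\<^sub>1 \<in> carrier M; m\<^sub>2 \<in> carrier M;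
      elem_prod R M m\<^sub>1 m\<^sub>2 \<noteq> {\<zero>\<^bsub>M\<^esub>}; elem_prod R M m\<^sub>1 m\<^sub>2 \<subseteq> N\<rbrakk>
      \<Longrightarrow> m\<^sub>1 \<in> module_radical R M \<or> m\<^sub>2 \<in> N"
  shows "weakly_J_submodule N R M"
proof -
  let ?J = "module_radical R M"
  have "m \<in> N" if r: "r \<in> carrier R" and m: "m \<in> carrier M"
    and rm: "r \<odot>\<^bsub>M\<^esub> m \<noteq> \<zero>\<^bsub>M\<^esub>" "r \<odot>\<^bsub>M\<^esub> m \<in> N"
    and rJ: "r \<notin> residual R M (ideal_smult R M (jacobson_radical R))" for r m
  proof -
    obtain I where I: "ideal I R" "submodule_gen R M {m} = ideal_smult R M I"
      by (rule cyclic_eq_ideal_smult[OF mult m])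
    have eq: "elem_prod R M (r \<odot>\<^bsub>M\<^esub> x) m = {a \<odot>\<^bsub>M\<^esub> (r \<odot>\<^bsub>M\<^esub> x) | a. a \<in> I}"
      if "x \<in> carrier M" for x
      using elem_prod_commute[OF mult _ m, of "r \<odot>\<^bsub>M\<^esub> x"]
        elem_prod_eq_ideal_line[OF mult m _ I, of "r \<odot>\<^bsub>M\<^esub> x"] r that by simp
    have swap: "a \<odot>\<^bsub>M\<^esub> (r \<odot>\<^bsub>M\<^esub> x) = r \<odot>\<^bsub>M\<^esub> (a \<odot>\<^bsub>M\<^esub> x)" if "a \<in> I" "x \<in> carrier M" for a x
      using that r ideal.Icarr[OF I(1)] by (simp add: smult_assoc1[symmetric] R.m_comm)
    have sub: "elem_prod R M (r \<odot>\<^bsub>M\<^esub> x) m \<subseteq> N" if x: "x \<in> carrier M" for x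
    proof -
      have "submodule_gen R M {m} \<subseteq> {x \<in> carrier M. r \<odot>\<^bsub>M\<^esub> x \<in> N}"
        using m rm(2) by (intro submodule_gen_least[OF submodule_smult_vimage[OF N(1) r]]) simp
      then show ?thesis
        unfolding eq[OF x] I(2) using swap[OF _ x] ideal_smultI[OF _ x, of _ I R] by force
    qed
    have step: "m \<in> N"
      if "x \<in> carrier M" "r \<odot>\<^bsub>M\<^esub> x \<notin> ?J" "a \<in> I" "a \<odot>\<^bsub>M\<^esub> (r \<odot>\<^bsub>M\<^esub> x) \<noteq> \<zero>\<^bsub>M\<^esub>" for x a
      using cond[OF _ m _ sub[OF that(1)]] that r eq[OF that(1)] by auto
    have "r \<notin> residual R M ?J"
    proof
      assume "r \<in> residual R M ?J"
      then have "r \<in> jacobson_radical R"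
        using residual_module_radical_subset[OF fg ff mult] by blast
      then show False
        using rJ r ideal_smultI[of r "jacobson_radical R" _ M R] unfolding residual_def by blast
    qed
    then obtain x where x: "x \<in> carrier M" "r \<odot>\<^bsub>M\<^esub> x \<notin> ?J"
      using r unfolding residual_def by blast
    have "\<exists>a \<in> I. \<exists>y \<in> carrier M. a \<odot>\<^bsub>M\<^esub> (r \<odot>\<^bsub>M\<^esub> y) \<noteq> \<zero>\<^bsub>M\<^esub>"
    proof (rule ccontr)
      assume "\<not> ?thesis"
      then have "ideal_smult R M I \<subseteq> {x \<in> carrier M. r \<odot>\<^bsub>M\<^esub> x \<in> {\<zero>\<^bsub>M\<^esub>}}"
        using swap ideal.Icarr[OF I(1)]
        by (intro ideal_smult_least[OF submodule_smult_vimage[OF submodule_zero_set r]]) auto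
      then show False
        using rm(1) I(2) submodule_gen_incl[of "{m}" R M] by blast
    qed
    then obtain a y where ay: "a \<in> I" "y \<in> carrier M" "a \<odot>\<^bsub>M\<^esub> (r \<odot>\<^bsub>M\<^esub> y) \<noteq> \<zero>\<^bsub>M\<^esub>"
      by blast
    have aR: "a \<in> carrier R"
      using ideal.Icarr[OF I(1) ay(1)] .
    consider "a \<odot>\<^bsub>M\<^esub> (r \<odot>\<^bsub>M\<^esub> x) \<noteq> \<zero>\<^bsub>M\<^esub>" | "r \<odot>\<^bsub>M\<^esub> y \<notin> ?J"
      | "a \<odot>\<^bsub>M\<^esub> (r \<odot>\<^bsub>M\<^esub> x) = \<zero>\<^bsub>M\<^esub>" "r \<odot>\<^bsub>M\<^esub> y \<in> ?J"
      by blast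
    then show ?thesis
    proof cases
      case 3
      have "r \<odot>\<^bsub>M\<^esub> (x \<oplus>\<^bsub>M\<^esub> y) \<notin> ?J"
      proof
        assume "r \<odot>\<^bsub>M\<^esub> (x \<oplus>\<^bsub>M\<^esub> y) \<in> ?J"
        then have "r \<odot>\<^bsub>M\<^esub> (x \<oplus>\<^bsub>M\<^esub> y) \<oplus>\<^bsub>M\<^esub> \<ominus>\<^bsub>M\<^esub> (r \<odot>\<^bsub>M\<^esub> y) \<in> ?J"
          using 3(2) by (intro submoduleE(3,5)[OF module_radical_submodule])
        moreover have "r \<odot>\<^bsub>M\<^esub> (x \<oplus>\<^bsub>M\<^esub> y) \<oplus>\<^bsub>M\<^esub> \<ominus>\<^bsub>M\<^esub> (r \<odot>\<^bsub>M\<^esub> y) = r \<odot>\<^bsub>M\<^esub> x"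
          using r x(1) ay(2) by (simp add: smult_r_distr M.a_assoc M.r_neg)
        ultimately show False
          using x(2) by simp
      qed
      moreover have "a \<odot>\<^bsub>M\<^esub> (r \<odot>\<^bsub>M\<^esub> (x \<oplus>\<^bsub>M\<^esub> y)) = a \<odot>\<^bsub>M\<^esub> (r \<odot>\<^bsub>M\<^esub> y)"
        using aR r x(1) ay(2) 3(1) by (simp add: smult_r_distr)
      ultimately show ?thesis
        using step[of "x \<oplus>\<^bsub>M\<^esub> y" a] x(1) ay by simp
    qed (use step x ay in auto)
  qed
  then show ?thesis
    using N unfolding weakly_J_submodule_def by blast
qed

end

theorem corollary3:
  fixes R :: "('a, 'r) ring_scheme"
    and M :: "('a, 'b, 'm) module_scheme"
    and N :: "'b set"
  assumes "module R M"
    and "finitely_generated_module R M"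
    and "faithful_module R M"
    and "multiplication_module R M"
    and "submodule N R M"
    and "N \<noteq> carrier M"
  shows "weakly_J_submodule N R M \<longleftrightarrow>
    (\<forall>m\<^sub>1 \<in> carrier M. \<forall>m\<^sub>2 \<in> carrier M.
       elem_prod R M m\<^sub>1 m\<^sub>2 \<noteq> {\<zero>\<^bsub>M\<^esub>} \<and> elem_prod R M m\<^sub>1 m\<^sub>2 \<subseteq> N \<longrightarrow>
       m\<^sub>1 \<in> module_radical R M \<or> m\<^sub>2 \<in> N)"
proof -
  interpret module R M by (rule assms(1))
  show ?thesis
    using weakly_J_submodule_elem_prod[OF assms(4)]
      elem_prod_imp_weakly_J_submodule[OF assms(2-6)] by blast
qed

end
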